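(* Every $\omega_1$-compact (hence every Lindelöf) regular space $X$ with $|X| = \Delta(X) = \omega_1$ is $\omega_1$-resolvable.
   Context: Regular spaces are understood to be $T_1$ (so regular implies Hausdorff). For a cardinal $\lambda$, a topological space $X$ is $\lambda$-resolvable if it contains $\lambda$ many pairwise disjoint dense subsets. The dispersion character of $X$ is $\Delta(X)=\min\{|G| : G \text{ is a non-empty open subset of } X\}$. A point $x\in X$ is a complete accumulation point of an infinite set $A\subset X$ if $|U\cap A|=|A|$ for every neighbourhood $U$ of $x$. A space $X$ is $\omega_1$-compact if every subset of $X$ of cardinality $\omega_1$ has a complete accumulation point in $X$. *)

theory Defs
  imports "HOL-Analysis.Analysis"
begin

unbundle cardinal_syntax

text \<open>
  Cardinals are represented by cardinal well-orders as in the HOL cardinals library: \<open>|A|\<close> is the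
  cardinal of \<open>A\<close>, and equality of cardinals, possibly over different types, is \<open>=o\<close>.
\<close>

definition omega1 :: "nat set rel" where
  "omega1 = cardSuc natLeq"

definition dense_subset :: "'a topology \<Rightarrow> 'a set \<Rightarrow> bool" where
  "dense_subset X D \<longleftrightarrow> D \<subseteq> topspace X \<and> X closure_of D = topspace X"

definition resolvable :: "'b rel \<Rightarrow> 'a topology \<Rightarrow> bool" where
  "resolvable r X \<longleftrightarrow>
     (\<exists>\<D>. |\<D>| =o r \<and> pairwise disjnt \<D> \<and> (\<forall>D\<in>\<D>. dense_subset X D))"

definition open_cardinals :: "'a topology \<Rightarrow> 'a rel set" where
  "open_cardinals X = {|G| |G. openin X G \<and> G \<noteq> {}}"

text \<open>
  The minimum is taken with respect to \<open>\<le>o\<close>, which is only a preorder on cardinal well-orders;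
  hence the choice, which is unique up to \<open>=o\<close>. The value is unspecified if the space is empty.
\<close>

definition dispersion_character :: "'a topology \<Rightarrow> 'a rel" where
  "dispersion_character X =
     (SOME r. r \<in> open_cardinals X \<and> (\<forall>r'\<in>open_cardinals X. r \<le>o r'))"

lemma dispersion_character:
  assumes "topspace X \<noteq> {}"
  shows dispersion_character_in: "dispersion_character X \<in> open_cardinals X"
    and dispersion_character_le: "r \<in> open_cardinals X \<Longrightarrow> dispersion_character X \<le>o r"
proof -
  have "|topspace X| \<in> open_cardinals X"
    using assms by (auto simp: open_cardinals_def)
  then have "\<exists>r\<in>open_cardinals X. \<forall>r'\<in>open_cardinals X. r \<le>o r'"
    by (intro exists_minim_Card_order) (auto simp: open_cardinals_def card_of_Card_order)
  then have "\<exists>r. r \<in> open_cardinals X \<and> (\<forall>r'\<in>open_cardinals X. r \<le>o r')"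
    by blast
  then have *: "dispersion_character X \<in> open_cardinals X \<and>
      (\<forall>r'\<in>open_cardinals X. dispersion_character X \<le>o r')"
    unfolding dispersion_character_def by (rule someI_ex)
  show "dispersion_character X \<in> open_cardinals X"
    using * by blast
  show "dispersion_character X \<le>o r" if "r \<in> open_cardinals X"
    using * that by blast
qed

definition complete_accumulation_point :: "'a topology \<Rightarrow> 'a set \<Rightarrow> 'a \<Rightarrow> bool" where
  "complete_accumulation_point X A x \<longleftrightarrow>
     infinite A \<and> A \<subseteq> topspace X \<and> x \<in> topspace X \<and>
     (\<forall>U. openin X U \<and> x \<in> U \<longrightarrow> |U \<inter> A| =o |A| )"

definition omega1_compact :: "'a topology \<Rightarrow> bool" where
  "omega1_compact X \<longleftrightarrow>
     (\<forall>A. A \<subseteq> topspace X \<and> |A| =o omega1 \<longrightarrow> (\<exists>x. complete_accumulation_point X A x))"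

end

theory Submission
  imports Defs "HOL-Library.Countable_Set_Type"
begin

text \<open>
  Both hypotheses give every uncountable set \<open>D\<close> a point all of whose neighbourhoods meet \<open>D\<close> in an
  uncountable set, and a \<open>\<sigma>\<close>-ideal \<open>I\<close> has a kernel, the closed set of points
  without neighbourhoods in \<open>I\<close>. An Ulam matrix on \<open>\<omega>\<^sub>1\<close> yields a decreasing sequence of \<open>\<sigma>\<close>-ideals
  \<open>I\<^sub>n\<close> whose only common members are the countable sets, and which are tall: every
  uncountable set contains an uncountable member. The increasing kernels \<open>K\<^sub>n\<close> then have a dense union.

  By tallness and a diagonal argument, densely many points \<open>z\<close> of \<open>K\<^sub>n\<close> lie, for each given \<open>B \<in> I\<^sub>n\<close>,
  in the closure of some \<open>T \<in> I\<^sub>n\<close> that is disjoint from \<open>B\<close> and condenses only at points of \<open>K\<^sub>n\<close>.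
  A recursion of length \<open>\<omega>\<^sub>1\<close> picks disjoint such sets, \<open>\<omega>\<^sub>1\<close> many for each of these \<open>z\<close> with
  \<open>n\<close> minimal. It never gets stuck: near \<open>z\<close>, the sets chosen at levels below \<open>n\<close> have a countable
  union, since they condense only at the closed set \<open>K\<^bsub>n-1\<^esub>\<close>, which misses \<open>z\<close>; those chosen
  at levels from \<open>n\<close> on have their union in \<open>I\<^sub>n\<close>.
\<close>

section \<open>Well-orders of type \<open>\<omega>\<^sub>1\<close> and ideals\<close>

lemma omega1_le_iff: "omega1 \<le>o |D| \<longleftrightarrow> uncountable D"
proof -
  have "omega1 \<le>o |D| \<longleftrightarrow> natLeq <o |D|"
    unfolding omega1_def
    using cardSuc_ordLess_ordLeq[OF natLeq_Card_order card_of_Card_order, of D] by simp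
  also have "\<dots> \<longleftrightarrow> uncountable D"
    by (simp add: countable_card_le_natLeq not_ordLeq_iff_ordLess natLeq_Well_order card_of_Well_order)
  finally show ?thesis .
qed

lemma card_eq_omega1:
  assumes "|A| =o omega1" "D \<subseteq> A" "uncountable D"
  shows "|D| =o omega1"
  using assms ordLeq_ordIso_trans[OF card_of_mono1[OF assms(2)] assms(1)]
  by (simp add: ordIso_iff_ordLeq omega1_le_iff)

text \<open>\<open>R\<close> is a strict order. Countable initial segments of an uncountable set are
  what a recursion needs: each stage has only countably many predecessors, which a \<sigma>-ideal
  can absorb.\<close>

locale omega1_order =
  fixes A :: "'a set" and R :: "'a rel"
  assumes wf_R: "wf R"
    and total_R: "total_on A R"
    and R_subset: "R \<subseteq> A \<times> A"
    and countable_below: "countable {b. (b, a) \<in> R}"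
    and uncountable_A: "uncountable A"

text \<open>The cardinal of \<open>A\<close> is itself a well-order of \<open>A\<close>. Its proper
  initial segments have smaller cardinality, hence are countable; \<open>R\<close> is its strict
  part.\<close>

lemma ex_omega1_order:
  assumes "|A| =o omega1"
  shows "\<exists>R. omega1_order A R"
proof
  let ?r = "|A|"
  have wo: "well_order_on A ?r"
    by (rule card_of_well_order_on)
  show "omega1_order A (?r - Id)"
  proof
    show "wf (?r - Id)" "total_on A (?r - Id)"
      using wo by (auto simp: well_order_on_def linear_order_on_def total_on_def)
    show "?r - Id \<subseteq> A \<times> A"
      using wo well_order_on_domain by fastforce
    show "countable {b. (b, a) \<in> ?r - Id}" for a
    proof (cases "a \<in> A")
      case True
      then have "|underS ?r a| <o ?r"
        by (intro card_of_underS) (simp_all add: card_of_card_order_on Field_card_of True)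
      then have "|underS ?r a| <o omega1"
        using assms by (rule ordLess_ordIso_trans)
      then have "|underS ?r a| \<le>o natLeq"
        unfolding omega1_def
        by (rule cardSuc_ordLeq_ordLess[OF natLeq_Card_order card_of_Card_order, THEN iffD1])
      then have "countable (underS ?r a)"
        by (simp only: countable_card_le_natLeq)
      then show ?thesis
        by (rule countable_subset[rotated]) (auto simp: underS_def)
    next
      case False
      then have "{b. (b, a) \<in> ?r - Id} = {}"
        using wo well_order_on_domain by fastforce
      then show ?thesis by (simp only: countable_empty)
    qed
    show "uncountable A"
      using ordIso_imp_ordLeq[OF ordIso_symmetric[OF assms]] by (simp add: omega1_le_iff)
  qed
qed

section \<open>\<sigma>-ideals containing the countable sets\<close>

definition sigma_ideal :: "'a set set \<Rightarrow> bool" where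
  "sigma_ideal I \<longleftrightarrow> (\<forall>B\<in>I. \<forall>C\<subseteq>B. C \<in> I) \<and> (\<forall>\<C>\<subseteq>I. countable \<C> \<longrightarrow> \<Union>\<C> \<in> I) \<and>
     (\<forall>B. countable B \<longrightarrow> B \<in> I)"

lemma sigma_ideal_subset: "sigma_ideal I \<Longrightarrow> B \<in> I \<Longrightarrow> C \<subseteq> B \<Longrightarrow> C \<in> I"
  and sigma_ideal_countable: "sigma_ideal I \<Longrightarrow> countable B \<Longrightarrow> B \<in> I"
  by (auto simp: sigma_ideal_def)

lemma sigma_ideal_UN:
  assumes "sigma_ideal I" "countable J" "\<And>j. j \<in> J \<Longrightarrow> S j \<in> I"
  shows "(\<Union>j\<in>J. S j) \<in> I"
proof -
  have "S ` J \<subseteq> I" "countable (S ` J)"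
    using assms by auto
  then show ?thesis
    using assms(1) unfolding sigma_ideal_def by blast
qed

lemma sigma_ideal_Un:
  assumes "sigma_ideal I" "B \<in> I" "C \<in> I"
  shows "B \<union> C \<in> I"
  using sigma_ideal_UN[OF assms(1), of "{B, C}" "\<lambda>x. x"] assms by auto

definition tall :: "'a set set \<Rightarrow> bool" where
  "tall I \<longleftrightarrow> (\<forall>D. uncountable D \<longrightarrow> (\<exists>D'\<subseteq>D. uncountable D' \<and> D' \<in> I))"

lemma sigma_ideal_INT:
  fixes I :: "'b \<Rightarrow> 'a set set"
  assumes "\<And>m. m \<in> M \<Longrightarrow> sigma_ideal (I m)"
  shows "sigma_ideal (\<Inter>m\<in>M. I m)"
  unfolding sigma_ideal_def
proof (intro conjI allI impI ballI)
  fix B C assume "B \<in> (\<Inter>m\<in>M. I m)" "C \<subseteq> B"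
  then show "C \<in> (\<Inter>m\<in>M. I m)"
    using sigma_ideal_subset[OF assms] by (intro INT_I) auto
next
  fix \<C> assume sub: "\<C> \<subseteq> (\<Inter>m\<in>M. I m)" and "countable \<C>"
  show "\<Union>\<C> \<in> (\<Inter>m\<in>M. I m)"
  proof (rule INT_I)
    fix m assume m: "m \<in> M"
    then show "\<Union>\<C> \<in> I m"
      using sigma_ideal_UN[OF assms[OF m] \<open>countable \<C>\<close>, of "\<lambda>C. C"] sub by auto
  qed
next
  fix B :: "'a set" assume "countable B"
  then show "B \<in> (\<Inter>m\<in>M. I m)"
    using sigma_ideal_countable[OF assms] by (intro INT_I)
qed

section \<open>Transfinite choice and the Ulam matrix\<close>

context omega1_order
begin

text \<open>Well-founded recursion: at each stage the earlier values and earlier \<open>S j\<close>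
  form a countable union of members of \<open>I\<close>, which cannot cover
  \<open>C\<close>.\<close>

lemma avoiding_sequence:
  assumes I: "sigma_ideal I" and C: "C \<notin> I" and S: "\<And>j. j \<in> A \<Longrightarrow> S j \<in> I"
  obtains d where "inj_on d A" "\<And>i. i \<in> A \<Longrightarrow> d i \<in> C"
    "\<And>i j. (j, i) \<in> R \<Longrightarrow> d i \<notin> S j"
proof -
  have "\<exists>d. \<forall>i. d i \<in> C \<and> (\<forall>j. (j, i) \<in> R \<longrightarrow> d i \<noteq> d j \<and> d i \<notin> S j)"
  proof (rule dependent_wf_choice[OF wf_R])
    fix f g :: "'a \<Rightarrow> 'b" and x r
    assume "\<And>z. (z, x) \<in> R \<Longrightarrow> f z = g z"
    then show "(r \<in> C \<and> (\<forall>j. (j, x) \<in> R \<longrightarrow> r \<noteq> f j \<and> r \<notin> S j)) =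
        (r \<in> C \<and> (\<forall>j. (j, x) \<in> R \<longrightarrow> r \<noteq> g j \<and> r \<notin> S j))"
      by auto
  next
    fix x and f :: "'a \<Rightarrow> 'b"
    have "(\<Union>j\<in>{j. (j, x) \<in> R}. insert (f j) (S j)) \<in> I"
    proof (rule sigma_ideal_UN[OF I countable_below])
      fix j assume "j \<in> {j. (j, x) \<in> R}"
      then have "S j \<in> I" using R_subset S by auto
      then show "insert (f j) (S j) \<in> I"
        using sigma_ideal_Un[OF I, of "{f j}"] sigma_ideal_countable[OF I, of "{f j}"] by auto
    qed
    then have "\<not> C \<subseteq> (\<Union>j\<in>{j. (j, x) \<in> R}. insert (f j) (S j))"
      using C sigma_ideal_subset[OF I] by blast
    then show "\<exists>r. r \<in> C \<and> (\<forall>j. (j, x) \<in> R \<longrightarrow> r \<noteq> f j \<and> r \<notin> S j)"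
      by blast
  qed
  then obtain d where d: "\<And>i. d i \<in> C" "\<And>i j. (j, i) \<in> R \<Longrightarrow> d i \<noteq> d j \<and> d i \<notin> S j"
    by blast
  have "inj_on d A"
    using d(2) total_R unfolding inj_on_def total_on_def by metis
  then show thesis
    using that d by blast
qed

text \<open>The Ulam matrix: \<open>m\<close> is the index of \<open>a\<close> in a fixed
  enumeration of the predecessors of \<open>i\<close>. The entries of one row \<open>m\<close> are
  disjoint, and the column of \<open>a\<close> covers everything above \<open>a\<close>.\<close>

definition ulam :: "nat \<Rightarrow> 'a \<Rightarrow> 'a set" where
  "ulam m a = {i. (a, i) \<in> R \<and> to_nat_on {b. (b, i) \<in> R} a = m}"

lemma ulam_disjoint: "i \<in> ulam m a \<Longrightarrow> i \<in> ulam m b \<Longrightarrow> a = b"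
  using inj_on_to_nat_on[OF countable_below, of i] by (auto simp: ulam_def inj_on_def)

definition ulam_ideal :: "nat \<Rightarrow> 'a set set" where
  "ulam_ideal m = {B. countable {a. uncountable (B \<inter> ulam m a)}}"

lemma sigma_ideal_ulam_ideal: "sigma_ideal (ulam_ideal m)"
  unfolding sigma_ideal_def
proof (intro conjI allI impI ballI)
  fix B C assume "B \<in> ulam_ideal m" "C \<subseteq> B"
  then have "countable {a. uncountable (B \<inter> ulam m a)}"
    by (simp only: ulam_ideal_def mem_Collect_eq)
  moreover have "{a. uncountable (C \<inter> ulam m a)} \<subseteq> {a. uncountable (B \<inter> ulam m a)}"
    using countable_subset[OF Int_mono[OF \<open>C \<subseteq> B\<close> order_refl]] by (intro Collect_mono) metis
  ultimately have "countable {a. uncountable (C \<inter> ulam m a)}"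
    by (rule countable_subset[rotated])
  then show "C \<in> ulam_ideal m"
    by (simp only: ulam_ideal_def mem_Collect_eq)
next
  fix \<C> assume sub: "\<C> \<subseteq> ulam_ideal m" and "countable \<C>"
  have "\<exists>C\<in>\<C>. uncountable (C \<inter> ulam m a)" if "uncountable (\<Union>\<C> \<inter> ulam m a)" for a
  proof (rule ccontr)
    assume "\<not> ?thesis"
    then have "countable (\<Union>C\<in>\<C>. C \<inter> ulam m a)"
      by (intro countable_UN[OF \<open>countable \<C>\<close>]) metis
    then show False
      using that unfolding Int_Union2 by contradiction
  qed
  then have "{a. uncountable (\<Union>\<C> \<inter> ulam m a)} \<subseteq> (\<Union>C\<in>\<C>. {a. uncountable (C \<inter> ulam m a)})"
    by (intro subsetI) (simp only: mem_Collect_eq UN_iff)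
  moreover have "countable (\<Union>C\<in>\<C>. {a. uncountable (C \<inter> ulam m a)})"
    using \<open>countable \<C>\<close>
  proof (rule countable_UN)
    fix C assume "C \<in> \<C>"
    with sub have "C \<in> ulam_ideal m" by (rule subsetD)
    then show "countable {a. uncountable (C \<inter> ulam m a)}"
      by (simp only: ulam_ideal_def mem_Collect_eq)
  qed
  ultimately have "countable {a. uncountable (\<Union>\<C> \<inter> ulam m a)}"
    by (rule countable_subset)
  then show "\<Union>\<C> \<in> ulam_ideal m"
    by (simp only: ulam_ideal_def mem_Collect_eq)
next
  fix B :: "'a set" assume "countable B"
  then have "countable (B \<inter> ulam m a)" for a
    by (rule countable_subset[rotated]) (rule Int_lower1)
  then show "B \<in> ulam_ideal m"
    by (simp add: ulam_ideal_def)
qed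

text \<open>If \<open>D\<close> meets one entry of the row in an uncountable set, that piece misses
  all other entries of the row; otherwise \<open>D\<close> is already in the ideal.\<close>

lemma tall_ulam_ideal:
  assumes "uncountable D"
  shows "\<exists>D'\<subseteq>D. uncountable D' \<and> D' \<in> ulam_ideal m"
proof (cases "\<exists>a. uncountable (D \<inter> ulam m a)")
  case True
  then obtain a where a: "uncountable (D \<inter> ulam m a)" by blast
  have "countable (D \<inter> ulam m a \<inter> ulam m b)" if "b \<noteq> a" for b
  proof -
    have "D \<inter> ulam m a \<inter> ulam m b = {}"
      using ulam_disjoint that by blast
    then show ?thesis by simp
  qed
  then have "{b. uncountable (D \<inter> ulam m a \<inter> ulam m b)} \<subseteq> {a}"
    by (intro subsetI) (metis mem_Collect_eq singletonI)
  then have "countable {b. uncountable (D \<inter> ulam m a \<inter> ulam m b)}"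
    by (rule countable_subset) simp
  then have "D \<inter> ulam m a \<in> ulam_ideal m"
    by (simp only: ulam_ideal_def mem_Collect_eq)
  then show ?thesis
    using a by (intro exI[of _ "D \<inter> ulam m a"] conjI Int_lower1)
next
  case False
  then have "{a. uncountable (D \<inter> ulam m a)} = {}"
    by (intro equals0I) (simp only: mem_Collect_eq, metis)
  then have "D \<in> ulam_ideal m"
    by (simp only: ulam_ideal_def mem_Collect_eq countable_empty)
  then show ?thesis
    using assms by (intro exI[of _ D] conjI order_refl)
qed

text \<open>If \<open>D\<close> lay in all these ideals, each row would exclude only countably many
  \<open>a\<close>. Some \<open>a\<close> would survive every row, and its column would meet
  \<open>D\<close> in a countable set although it covers \<open>D\<close> up to a countable initial
  segment.\<close>

lemma not_in_ulam_ideal: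
  assumes "D \<subseteq> A" "uncountable D"
  shows "\<exists>m. D \<notin> ulam_ideal m"
proof (rule ccontr)
  assume "\<not> ?thesis"
  then have "countable {a. uncountable (D \<inter> ulam m a)}" for m
    by (simp only: ulam_ideal_def mem_Collect_eq not_ex not_not)
  then have "countable (\<Union>m. {a. uncountable (D \<inter> ulam m a)})"
    by (intro countable_UN countableI_type)
  then have "\<not> A \<subseteq> (\<Union>m. {a. uncountable (D \<inter> ulam m a)})"
    using uncountable_A countable_subset by metis
  then obtain a where a: "a \<in> A" "\<And>m. countable (D \<inter> ulam m a)"
    by (simp only: subset_iff UN_iff UNIV_I mem_Collect_eq bex_simps) metis
  have "D \<subseteq> insert a {b. (b, a) \<in> R} \<union> (\<Union>m. D \<inter> ulam m a)"
  proof
    fix i assume "i \<in> D"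
    then show "i \<in> insert a {b. (b, a) \<in> R} \<union> (\<Union>m. D \<inter> ulam m a)"
      using total_R a(1) assms(1) by (auto simp: total_on_def ulam_def)
  qed
  moreover have "countable (insert a {b. (b, a) \<in> R} \<union> (\<Union>m. D \<inter> ulam m a))"
    using a(2) countable_below by (intro countable_Un countable_insert countable_UN countableI_type)
  ultimately show False
    using assms(2) countable_subset by metis
qed

text \<open>Intersecting the first rows makes the sequence decreasing; as each intersection is
  finite, tallness survives.\<close>

definition level_ideal :: "nat \<Rightarrow> 'a set set" where
  "level_ideal n = (\<Inter>m\<le>n. ulam_ideal m)"

lemma level_ideal_antimono: "m \<le> n \<Longrightarrow> level_ideal n \<subseteq> level_ideal m"
  by (auto simp: level_ideal_def)

lemma sigma_ideal_level_ideal: "sigma_ideal (level_ideal n)"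
  unfolding level_ideal_def by (intro sigma_ideal_INT sigma_ideal_ulam_ideal)

text \<open>An uncountable set is thinned out once per row; the earlier memberships pass to
  subsets.\<close>

lemma tall_level_ideal: "tall (level_ideal n)"
  unfolding tall_def
proof (intro allI impI)
  fix D :: "'a set" assume unc: "uncountable D"
  show "\<exists>D'\<subseteq>D. uncountable D' \<and> D' \<in> level_ideal n"
  proof (induction n)
    case 0
    then show ?case using tall_ulam_ideal[OF unc, of 0] by (simp add: level_ideal_def)
  next
    case (Suc n)
    then obtain D' where D': "D' \<subseteq> D" "uncountable D'" "D' \<in> level_ideal n"
      by metis
    obtain D'' where D'': "D'' \<subseteq> D'" "uncountable D''" "D'' \<in> ulam_ideal (Suc n)"
      using tall_ulam_ideal[OF D'(2)] by metis
    have "D'' \<in> level_ideal n"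
      using sigma_ideal_level_ideal D'(3) D''(1) by (rule sigma_ideal_subset)
    then have "D'' \<in> level_ideal (Suc n)"
      using D''(3) by (auto simp: level_ideal_def le_Suc_eq)
    then show ?case
      using D''(2) subset_trans[OF D''(1) D'(1)] by metis
  qed
qed

lemma not_in_level_ideal:
  assumes "D \<subseteq> A" "uncountable D"
  shows "\<exists>n. D \<notin> level_ideal n"
  using not_in_ulam_ideal[OF assms] by (auto simp: level_ideal_def)

end


section \<open>Spaces in which uncountable sets have condensation points\<close>

definition condensation_points :: "'a topology \<Rightarrow> 'a set \<Rightarrow> 'a set" where
  "condensation_points X D = {x \<in> topspace X. \<forall>U. openin X U \<and> x \<in> U \<longrightarrow> uncountable (U \<inter> D)}"

definition ideal_kernel :: "'a topology \<Rightarrow> 'a set set \<Rightarrow> 'a set" where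
  "ideal_kernel X I = {x \<in> topspace X. \<forall>U. openin X U \<and> x \<in> U \<longrightarrow> U \<notin> I}"

lemma condensation_points_mono:
  assumes "D \<subseteq> E"
  shows "condensation_points X D \<subseteq> condensation_points X E"
proof -
  have "countable (U \<inter> E) \<Longrightarrow> countable (U \<inter> D)" for U
    by (rule countable_subset[of _ "U \<inter> E"]) (use assms in blast)
  then show ?thesis
    unfolding condensation_points_def by blast
qed

lemma condensation_points_closedin:
  assumes "closedin X C" "D \<subseteq> C"
  shows "condensation_points X D \<subseteq> C"
proof
  fix x assume x: "x \<in> condensation_points X D"
  show "x \<in> C"
  proof (rule ccontr)
    assume "x \<notin> C"
    then have "openin X (topspace X - C)" "x \<in> topspace X - C"
      using assms(1) x by (auto simp: condensation_points_def)
    then have "uncountable ((topspace X - C) \<inter> D)"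
      using x unfolding condensation_points_def by blast
    moreover have "(topspace X - C) \<inter> D = {}"
      using assms(2) by blast
    ultimately show False by simp
  qed
qed

lemma closedin_ideal_kernel: "closedin X (ideal_kernel X I)"
proof -
  have "topspace X - ideal_kernel X I = \<Union>{U. openin X U \<and> U \<in> I}"
    by (auto simp: ideal_kernel_def dest: openin_subset)
  then have "openin X (topspace X - ideal_kernel X I)"
    by auto
  then show ?thesis
    unfolding closedin_def by (auto simp: ideal_kernel_def)
qed

text \<open>\<open>B\<close> stands for what earlier choices have used up near \<open>z\<close>, and
  \<open>T\<close> for the next choice. The kernel condition keeps \<open>T\<close> locally
  countable off the kernel.\<close>

definition avoidable_point :: "'a topology \<Rightarrow> 'a set set \<Rightarrow> 'a \<Rightarrow> bool" where
  "avoidable_point X I z \<longleftrightarrow> (\<forall>B\<in>I. \<exists>T\<in>I. T \<subseteq> topspace X \<and> T \<inter> B = {} \<and>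
     condensation_points X T \<subseteq> ideal_kernel X I \<and> z \<in> X closure_of T)"

text \<open>The common ground of the two compactness hypotheses. The points of the space also serve
  as stages of the recursions.\<close>

locale condensing_space = omega1_order "topspace X" R for X :: "'a topology" and R +
  assumes regular: "regular_space X"
    and condensing: "D \<subseteq> topspace X \<Longrightarrow> uncountable D \<Longrightarrow> condensation_points X D \<noteq> {}"
    and uncountable_openin: "openin X G \<Longrightarrow> G \<noteq> {} \<Longrightarrow> uncountable G"
begin

lemma ex_closed_neighbourhood:
  assumes "openin X G" "x \<in> G"
  obtains U C where "openin X U" "closedin X C" "x \<in> U" "U \<subseteq> C" "C \<subseteq> G"
proof -
  have "neighbourhood_base_of (closedin X) X"
    using regular by (simp only: neighbourhood_base_of_closedin)
  then show thesis
    using assms that unfolding neighbourhood_base_of by metis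
qed

text \<open>Diagonalization: the value chosen at stage \<open>i\<close> avoids \<open>V j\<close>
  and \<open>B j\<close> for all earlier \<open>j\<close>, so each \<open>V y\<close> and each
  \<open>B y\<close> catches only countably many values.\<close>

lemma ex_thin_subset:
  assumes I: "sigma_ideal I"
    and tall: "tall I"
    and C: "C \<subseteq> topspace X" "C \<notin> I"
    and B: "\<And>y. y \<in> topspace X \<Longrightarrow> B y \<in> I"
  obtains T where "T \<subseteq> C" "uncountable T" "T \<in> I"
    "condensation_points X T \<subseteq> ideal_kernel X I" "\<And>y. y \<in> topspace X \<Longrightarrow> countable (T \<inter> B y)"
proof -
  \<comment> \<open>Off the kernel, \<open>V y\<close> is a neighbourhood of \<open>y\<close> in
    \<open>I\<close>; on the kernel, the empty set serves as default.\<close>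
  have "\<exists>V. V \<in> I \<and> (y \<notin> ideal_kernel X I \<longrightarrow> openin X V \<and> y \<in> V)" if "y \<in> topspace X" for y
    using that sigma_ideal_countable[OF I, of "{}"] by (auto simp: ideal_kernel_def)
  then obtain V where V: "\<And>y. y \<in> topspace X \<Longrightarrow> V y \<in> I"
    "\<And>y. y \<in> topspace X \<Longrightarrow> y \<notin> ideal_kernel X I \<Longrightarrow> openin X (V y) \<and> y \<in> V y"
    by metis
  have "V y \<union> B y \<in> I" if "y \<in> topspace X" for y
    using V(1)[OF that] B[OF that] by (rule sigma_ideal_Un[OF I])
  then obtain d where d: "inj_on d (topspace X)" "\<And>i. i \<in> topspace X \<Longrightarrow> d i \<in> C"
    "\<And>i j. (j, i) \<in> R \<Longrightarrow> d i \<notin> V j \<union> B j"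
    using avoiding_sequence[OF I C(2), of "\<lambda>y. V y \<union> B y"] by metis
  have "uncountable (d ` topspace X)"
    using uncountable_A countable_image_inj_eq[OF d(1)] by simp
  \<comment> \<open>The range of \<open>d\<close> may lie outside \<open>I\<close>; tallness
    supplies an uncountable part of it inside \<open>I\<close>.\<close>
  then obtain T where T: "T \<subseteq> d ` topspace X" "uncountable T" "T \<in> I"
    using tall unfolding tall_def by metis
  have meets: "countable (T \<inter> (V y \<union> B y))" if y: "y \<in> topspace X" for y
  proof (rule countable_subset)
    show "T \<inter> (V y \<union> B y) \<subseteq> d ` insert y {i. (i, y) \<in> R}"
    proof
      fix t assume t: "t \<in> T \<inter> (V y \<union> B y)"
      then obtain i where i: "i \<in> topspace X" "t = d i"
        using T(1) by blast
      then have "(y, i) \<notin> R"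
        using d(3) t by blast
      then have "i = y \<or> (i, y) \<in> R"
        using total_R i(1) y unfolding total_on_def by blast
      then show "t \<in> d ` insert y {i. (i, y) \<in> R}"
        using i(2) by blast
    qed
    show "countable (d ` insert y {i. (i, y) \<in> R})"
      using countable_below by simp
  qed
  show thesis
  proof
    show "T \<subseteq> C" using T(1) d(2) by blast
    show "condensation_points X T \<subseteq> ideal_kernel X I"
    proof
      fix y assume y: "y \<in> condensation_points X T"
      then have "y \<in> topspace X" by (simp add: condensation_points_def)
      show "y \<in> ideal_kernel X I"
      proof (rule ccontr)
        assume "y \<notin> ideal_kernel X I"
        then have "uncountable (V y \<inter> T)"
          using V(2)[OF \<open>y \<in> topspace X\<close>] y unfolding condensation_points_def by blast
        moreover have "V y \<inter> T \<subseteq> T \<inter> (V y \<union> B y)"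
          by blast
        ultimately show False
          using meets[OF \<open>y \<in> topspace X\<close>] countable_subset by metis
      qed
    qed
    show "countable (T \<inter> B y)" if "y \<in> topspace X" for y
      by (rule countable_subset[OF _ meets[OF that]]) blast
  qed (use T in auto)
qed

text \<open>Otherwise each candidate \<open>y\<close> has a witness \<open>B y\<close> against it. A
  thin \<open>T\<close> within \<open>C\<close> meets every \<open>B y\<close> in a countable set
  and condenses at some candidate \<open>y\<close>; then \<open>T - B y\<close> still has
  \<open>y\<close> in its closure, which refutes \<open>B y\<close>.\<close>

lemma ex_avoidable_point:
  assumes I: "sigma_ideal I"
    and tall: "tall I"
    and C: "closedin X C" "C \<notin> I"
  shows "\<exists>z\<in>C \<inter> ideal_kernel X I. avoidable_point X I z"
proof (rule ccontr)
  assume no: "\<not> ?thesis"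
  let ?hits = "\<lambda>y B T. T \<subseteq> topspace X \<and> T \<inter> B = {} \<and>
     condensation_points X T \<subseteq> ideal_kernel X I \<and> y \<in> X closure_of T"
  have "\<exists>B. B \<in> I \<and> (y \<in> C \<inter> ideal_kernel X I \<longrightarrow> \<not> (\<exists>T\<in>I. ?hits y B T))" for y
  proof (cases "y \<in> C \<inter> ideal_kernel X I")
    case True
    then have "\<not> avoidable_point X I y"
      using no by metis
    then show ?thesis
      unfolding avoidable_point_def by metis
  next
    case False
    then show ?thesis
      using sigma_ideal_countable[OF I countable_empty] by metis
  qed
  then obtain B where B: "\<And>y. B y \<in> I"
    "\<And>y. y \<in> C \<inter> ideal_kernel X I \<Longrightarrow> \<not> (\<exists>T\<in>I. ?hits y (B y) T)"
    by metis
  have "C \<subseteq> topspace X" using C(1) by (rule closedin_subset)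
  obtain T where T: "T \<subseteq> C" "uncountable T" "T \<in> I"
    "condensation_points X T \<subseteq> ideal_kernel X I" "\<And>y. y \<in> topspace X \<Longrightarrow> countable (T \<inter> B y)"
    using ex_thin_subset[OF I tall \<open>C \<subseteq> topspace X\<close> C(2), of B] B(1) by metis
  then obtain y where y: "y \<in> condensation_points X T"
    using condensing[OF subset_trans[OF T(1) \<open>C \<subseteq> topspace X\<close>] T(2)] by blast
  then have "y \<in> C \<inter> ideal_kernel X I"
    using condensation_points_closedin[OF C(1) T(1)] T(4) by blast
  then have "y \<in> topspace X" using \<open>C \<subseteq> topspace X\<close> by blast
  have "y \<in> X closure_of (T - B y)"
    unfolding in_closure_of
  proof (intro conjI allI impI)
    fix U assume "y \<in> U \<and> openin X U"
    then have "uncountable (U \<inter> T)"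
      using y by (auto simp: condensation_points_def)
    then have "uncountable (U \<inter> T - T \<inter> B y)"
      using T(5)[OF \<open>y \<in> topspace X\<close>] by (rule uncountable_minus_countable)
    then have "U \<inter> T - T \<inter> B y \<noteq> {}"
      by (metis countable_empty)
    then show "\<exists>x. x \<in> T - B y \<and> x \<in> U" by blast
  qed (rule \<open>y \<in> topspace X\<close>)
  moreover have "T - B y \<in> I"
    using sigma_ideal_subset[OF I T(3)] by blast
  moreover have "condensation_points X (T - B y) \<subseteq> ideal_kernel X I"
    using condensation_points_mono[of "T - B y" T X] T(4) by blast
  moreover have "T - B y \<subseteq> topspace X"
    using T(1) \<open>C \<subseteq> topspace X\<close> by blast
  ultimately show False
    using B(2)[OF \<open>y \<in> C \<inter> ideal_kernel X I\<close>] by blast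
qed

section \<open>Kernels of the level ideals and the points to be served\<close>

definition kernel :: "nat \<Rightarrow> 'a set" where
  "kernel n = ideal_kernel X (level_ideal n)"

definition served :: "nat \<Rightarrow> 'a set" where
  "served n = {z \<in> kernel n. avoidable_point X (level_ideal n) z \<and> (\<forall>m<n. z \<notin> kernel m)}"

text \<open>A closed set inside \<open>G\<close> with nonempty interior is uncountable, so it
  escapes some level ideal and the kernel of that level meets \<open>G\<close>. At the least such
  level, a second closed neighbourhood inside \<open>G\<close> yields an avoidable point, which
  misses all lower kernels because \<open>G\<close> does.\<close>

lemma served_meets_openin:
  assumes G: "openin X G" "G \<noteq> {}"
  shows "\<exists>n. served n \<inter> G \<noteq> {}"
proof -
  have "\<exists>n. kernel n \<inter> G \<noteq> {}"
  proof -
    obtain x where "x \<in> G" using G by blast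
    then obtain U C where UC: "openin X U" "closedin X C" "x \<in> U" "U \<subseteq> C" "C \<subseteq> G"
      using ex_closed_neighbourhood G(1) by metis
    then have "uncountable C"
      using uncountable_openin[OF UC(1)] countable_subset[OF UC(4)] by (metis empty_iff)
    then obtain n where "C \<notin> level_ideal n"
      using not_in_level_ideal[OF closedin_subset[OF UC(2)]] by metis
    then obtain z where "z \<in> C \<inter> ideal_kernel X (level_ideal n)"
      using ex_avoidable_point[OF sigma_ideal_level_ideal tall_level_ideal UC(2)] by metis
    then show ?thesis
      using UC(5) unfolding kernel_def by blast
  qed
  then obtain n where n: "kernel n \<inter> G \<noteq> {}" "\<And>m. m < n \<Longrightarrow> kernel m \<inter> G = {}"
    using exists_least_iff[of "\<lambda>n. kernel n \<inter> G \<noteq> {}"] by metis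
  then obtain x where x: "x \<in> kernel n" "x \<in> G" by blast
  then obtain U C where UC: "openin X U" "closedin X C" "x \<in> U" "U \<subseteq> C" "C \<subseteq> G"
    using ex_closed_neighbourhood G(1) by metis
  have "U \<notin> level_ideal n"
    using x(1) UC(1,3) by (auto simp: kernel_def ideal_kernel_def)
  then have "C \<notin> level_ideal n"
    using sigma_ideal_subset[OF sigma_ideal_level_ideal _ UC(4)] by metis
  then obtain z where "z \<in> C \<inter> kernel n" "avoidable_point X (level_ideal n) z"
    using ex_avoidable_point[OF sigma_ideal_level_ideal tall_level_ideal UC(2)]
    unfolding kernel_def by metis
  then have "z \<in> served n \<inter> G"
    using n(2) UC(5) unfolding served_def by blast
  then show ?thesis by blast
qed

section \<open>Recursive choice of disjoint sets\<close>

definition admissible :: "nat \<Rightarrow> 'a set \<Rightarrow> bool" where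
  "admissible n T \<longleftrightarrow> T \<in> level_ideal n \<and> T \<subseteq> topspace X \<and> condensation_points X T \<subseteq> kernel n"

text \<open>Only the traces of the \<open>T j\<close> on a small neighbourhood \<open>U\<close> of
  \<open>z\<close> matter. With \<open>U\<close> inside a closed set off the lower kernels, these
  traces and their countable union lie in the ideal of level \<open>n\<close>, so avoidability of
  \<open>z\<close> applies.\<close>

lemma ex_disjoint_admissible:
  assumes z: "z \<in> served n" and J: "countable J"
    and T: "\<And>j. j \<in> J \<Longrightarrow> \<exists>k. admissible k (T j)"
  shows "\<exists>S. admissible n S \<and> z \<in> X closure_of S \<and> (\<forall>j\<in>J. S \<inter> T j = {})"
proof -
  obtain k where k: "\<And>j. j \<in> J \<Longrightarrow> admissible (k j) (T j)"
    using T by metis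
  let ?F = "\<Union>m<n. kernel m"
  have "closedin X ?F"
    by (intro closedin_Union) (auto simp: kernel_def closedin_ideal_kernel)
  moreover have "z \<in> topspace X - ?F"
    using z by (auto simp: served_def kernel_def ideal_kernel_def)
  ultimately obtain U C where UC: "openin X U" "closedin X C" "z \<in> U" "U \<subseteq> C"
    "C \<subseteq> topspace X - ?F"
    using ex_closed_neighbourhood[of "topspace X - ?F" z] by blast
  have "U \<inter> T j \<in> level_ideal n" if j: "j \<in> J" for j
  proof (cases "k j < n")
    case True
    \<comment> \<open>An uncountable trace would condense at a point of the closed set
      \<open>C\<close> that is also in \<open>kernel (k j)\<close>, one of the kernels avoided by
      \<open>C\<close>.\<close>
    have "countable (C \<inter> T j)"
    proof (rule ccontr)
      assume "uncountable (C \<inter> T j)"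
      then obtain y where y: "y \<in> condensation_points X (C \<inter> T j)"
        using condensing[of "C \<inter> T j"] closedin_subset[OF UC(2)] by (meson ex_in_conv le_infI1)
      then have "y \<in> C"
        using condensation_points_closedin[OF UC(2), of "C \<inter> T j"] by blast
      moreover have "y \<in> kernel (k j)"
        using y condensation_points_mono[of "C \<inter> T j" "T j" X] k[OF j]
        unfolding admissible_def by blast
      ultimately show False using UC(5) True by blast
    qed
    then have "countable (U \<inter> T j)"
      by (rule countable_subset[rotated]) (use UC(4) in blast)
    then show ?thesis
      by (rule sigma_ideal_countable[OF sigma_ideal_level_ideal])
  next
    case False
    then have "T j \<in> level_ideal n"
      using k[OF j] level_ideal_antimono[of n "k j"] unfolding admissible_def by auto
    then show ?thesis
      by (rule sigma_ideal_subset[OF sigma_ideal_level_ideal]) blast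
  qed
  then have "(\<Union>j\<in>J. U \<inter> T j) \<in> level_ideal n"
    by (rule sigma_ideal_UN[OF sigma_ideal_level_ideal J])
  moreover have "avoidable_point X (level_ideal n) z"
    using z by (simp add: served_def)
  ultimately obtain S where S: "S \<in> level_ideal n" "S \<subseteq> topspace X" "S \<inter> (\<Union>j\<in>J. U \<inter> T j) = {}"
    "condensation_points X S \<subseteq> kernel n" "z \<in> X closure_of S"
    unfolding avoidable_point_def kernel_def by metis
  \<comment> \<open>Cutting down to the open set \<open>U\<close> keeps \<open>z\<close> in the
    closure and turns disjointness from \<open>U \<inter> T j\<close> into disjointness from
    \<open>T j\<close>.\<close>
  have "z \<in> X closure_of (U \<inter> S)"
    using S(5) UC(1,3) openin_Int_closure_of_subset by fastforce
  moreover have "U \<inter> S \<in> level_ideal n"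
    by (rule sigma_ideal_subset[OF sigma_ideal_level_ideal S(1)]) blast
  then have "admissible n (U \<inter> S)"
    unfolding admissible_def
    using S(2,4) condensation_points_mono[of "U \<inter> S" S X] by blast
  moreover have "\<forall>j\<in>J. U \<inter> S \<inter> T j = {}"
    using S(3) by blast
  ultimately show ?thesis
    by metis
qed

text \<open>The bijection \<open>p\<close> gives every pair \<open>(z, c)\<close> its own stage. The
  union \<open>D c\<close> of the sets chosen at stages with second coordinate \<open>c\<close> has
  every served point in its closure, hence is dense.\<close>

lemma resolvable_omega1:
  assumes card: "|topspace X| =o omega1"
  shows "resolvable omega1 X"
proof -
  let ?A = "topspace X"
  have "infinite ?A"
    using uncountable_A uncountable_infinite by blast
  then have "|?A| =o |?A \<times> ?A|"
    by (rule ordIso_symmetric[OF card_of_Times_same_infinite])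
  then obtain p where p: "bij_betw p ?A (?A \<times> ?A)"
    using card_of_ordIso by metis
  define P where "P T a S \<longleftrightarrow> (\<exists>k. admissible k S) \<and>
      ((\<exists>n. fst (p a) \<in> served n) \<longrightarrow> fst (p a) \<in> X closure_of S) \<and>
      (\<forall>b. (b, a) \<in> R \<longrightarrow> S \<inter> T b = {})" for T a S
  have "\<exists>T. \<forall>a. P T a (T a)"
  proof (rule dependent_wf_choice[OF wf_R])
    fix f g :: "'a \<Rightarrow> 'a set" and a S
    assume "\<And>b. (b, a) \<in> R \<Longrightarrow> f b = g b"
    then show "P f a S = P g a S"
      unfolding P_def by auto
  next
    fix a and f :: "'a \<Rightarrow> 'a set"
    assume IH: "\<And>b. (b, a) \<in> R \<Longrightarrow> P f b (f b)"
    show "\<exists>S. P f a S"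
    proof (cases "\<exists>n. fst (p a) \<in> served n")
      case True
      then obtain n where n: "fst (p a) \<in> served n" by blast
      have "\<exists>k. admissible k (f b)" if "b \<in> {b. (b, a) \<in> R}" for b
        using IH[of b] that unfolding P_def by simp
      then obtain S where "admissible n S" "fst (p a) \<in> X closure_of S"
        "\<forall>b\<in>{b. (b, a) \<in> R}. S \<inter> f b = {}"
        using ex_disjoint_admissible[OF n countable_below] by metis
      then show ?thesis
        unfolding P_def by blast
    next
      case False
      \<comment> \<open>A stage whose first coordinate is not a served point chooses the empty set,
        for which any level would do.\<close>
      have "admissible 0 {}"
        unfolding admissible_def condensation_points_def kernel_def ideal_kernel_def
        using sigma_ideal_countable[OF sigma_ideal_level_ideal] by auto
      then show ?thesis
        unfolding P_def using False by blast
    qed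
  qed
  then obtain T where T: "\<And>a. P T a (T a)" by blast
  have disjoint: "T a \<inter> T b = {}" if "a \<in> ?A" "b \<in> ?A" "a \<noteq> b" for a b
    using T[of a] T[of b] that total_R unfolding P_def total_on_def by blast
  define D where "D c = (\<Union>a\<in>{a \<in> ?A. snd (p a) = c}. T a)" for c
  have D_disjoint: "disjnt (D c) (D c')" if "c \<noteq> c'" for c c'
    unfolding disjnt_def D_def using disjoint that by blast
  have dense: "dense_subset X (D c)" if c: "c \<in> ?A" for c
  proof -
    have sub: "D c \<subseteq> ?A"
      using T unfolding D_def P_def admissible_def by (intro UN_least) metis
    have "x \<in> X closure_of D c" if "x \<in> ?A" for x
      unfolding in_closure_of
    proof (intro conjI allI impI)
      fix G assume G: "x \<in> G \<and> openin X G"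
      then obtain n z where z: "z \<in> served n" "z \<in> G"
        using served_meets_openin[of G] by (metis disjoint_iff empty_iff)
      then have "z \<in> ?A" by (auto simp: served_def kernel_def ideal_kernel_def)
      then obtain a where a: "a \<in> ?A" "p a = (z, c)"
        using p c unfolding bij_betw_def by (metis (no_types, lifting) SigmaI imageE)
      then have "z \<in> X closure_of T a"
        using T[of a] z(1) unfolding P_def by auto
      then obtain y where "y \<in> T a" "y \<in> G"
        using G z(2) unfolding in_closure_of by blast
      then show "\<exists>y. y \<in> D c \<and> y \<in> G"
        using a unfolding D_def by (intro exI[of _ y]) auto
    qed (rule that)
    then show ?thesis
      unfolding dense_subset_def using sub closure_of_subset_topspace[of X "D c"] by blast
  qed
  \<comment> \<open>Disjoint nonempty sets are distinct, so there are as many sets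
    \<open>D c\<close> as points.\<close>
  have "D c \<noteq> {}" if "c \<in> ?A" for c
    using dense[OF that] that unfolding dense_subset_def by auto
  then have "inj_on D ?A"
    using D_disjoint unfolding inj_on_def disjnt_def by (metis inf.idem)
  then have "|?A| =o |D ` ?A|"
    using card_of_ordIsoI inj_on_imp_bij_betw by metis
  then have "|D ` ?A| =o omega1"
    by (rule ordIso_transitive[OF ordIso_symmetric card])
  moreover have "pairwise disjnt (D ` ?A)"
    unfolding pairwise_def using D_disjoint by (metis imageE)
  ultimately show ?thesis
    unfolding resolvable_def using dense by blast
qed

end

section \<open>Condensation points from the two compactness hypotheses\<close>

lemma Lindelof_condensing:
  assumes "Lindelof_space X" "D \<subseteq> topspace X" "uncountable D"
  shows "condensation_points X D \<noteq> {}"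
proof
  assume empty: "condensation_points X D = {}"
  \<comment> \<open>Without condensation points these open sets cover the space, and a countable
    subcover would make \<open>D\<close> countable.\<close>
  let ?\<U> = "{U. openin X U \<and> countable (U \<inter> D)}"
  have "\<Union>?\<U> = topspace X"
    using empty by (auto simp: condensation_points_def dest: openin_subset)
  then obtain \<V> where \<V>: "countable \<V>" "\<V> \<subseteq> ?\<U>" "\<Union>\<V> = topspace X"
    using assms(1) unfolding Lindelof_space_def by (metis (no_types, lifting) mem_Collect_eq)
  then have "countable (\<Union>V\<in>\<V>. V \<inter> D)"
    by (intro countable_UN) auto
  moreover have "D \<subseteq> (\<Union>V\<in>\<V>. V \<inter> D)"
    using \<V>(3) assms(2) by blast
  ultimately show False
    using assms(3) countable_subset by metis
qed

text \<open>In a space of size \<open>omega1\<close> an uncountable \<open>D\<close> has size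
  exactly \<open>omega1\<close>, so a complete accumulation point of \<open>D\<close> is a
  condensation point.\<close>

lemma omega1_compact_condensing:
  assumes "omega1_compact X" "|topspace X| =o omega1" "D \<subseteq> topspace X" "uncountable D"
  shows "condensation_points X D \<noteq> {}"
proof -
  have "|D| =o omega1"
    using card_eq_omega1 assms by blast
  then obtain x where x: "complete_accumulation_point X D x"
    using assms(1,3) unfolding omega1_compact_def by blast
  have "uncountable (U \<inter> D)" if "openin X U" "x \<in> U" for U
  proof -
    have "|U \<inter> D| =o |D|"
      using x that unfolding complete_accumulation_point_def by blast
    then have "|U \<inter> D| =o omega1"
      using \<open>|D| =o omega1\<close> by (rule ordIso_transitive)
    then show ?thesis
      by (rule omega1_le_iff[THEN iffD1, OF ordIso_imp_ordLeq[OF ordIso_symmetric]])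
  qed
  then show ?thesis
    using x unfolding condensation_points_def complete_accumulation_point_def by blast
qed

text \<open>The dispersion character bounds the size of nonempty open sets from below, so they are
  uncountable.\<close>

lemma resolvable_if_condensing:
  assumes "regular_space X" and card: "|topspace X| =o omega1"
    and disp: "dispersion_character X =o omega1"
    and cond: "\<And>D. D \<subseteq> topspace X \<Longrightarrow> uncountable D \<Longrightarrow> condensation_points X D \<noteq> {}"
  shows "resolvable omega1 X"
proof -
  obtain R where R: "omega1_order (topspace X) R"
    using ex_omega1_order[OF card] by blast
  have "uncountable G" if G: "openin X G" "G \<noteq> {}" for G
  proof -
    have "topspace X \<noteq> {}"
      using G openin_subset by blast
    moreover have "|G| \<in> open_cardinals X"
      using G by (auto simp: open_cardinals_def)
    ultimately have "dispersion_character X \<le>o |G|"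
      by (rule dispersion_character_le)
    then have "omega1 \<le>o |G|"
      by (rule ordIso_ordLeq_trans[OF ordIso_symmetric[OF disp]])
    then show ?thesis
      by (rule omega1_le_iff[THEN iffD1])
  qed
  then have "condensing_space X R"
    unfolding condensing_space_def condensing_space_axioms_def using R assms(1) cond by blast
  then show ?thesis
    using card by (rule condensing_space.resolvable_omega1)
qed

theorem corollary4p3:
  fixes X :: "'a topology"
  assumes "t1_space X" and "regular_space X"
    and "|topspace X| =o omega1"
    and "dispersion_character X =o omega1"
  shows "(omega1_compact X \<longrightarrow> resolvable omega1 X) \<and>
         (Lindelof_space X \<longrightarrow> resolvable omega1 X)"
proof (intro conjI impI)
  assume "omega1_compact X"
  then show "resolvable omega1 X"
    by (intro resolvable_if_condensing[OF assms(2-4)] omega1_compact_condensing[OF _ assms(3)])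
next
  assume "Lindelof_space X"
  then show "resolvable omega1 X"
    by (intro resolvable_if_condensing[OF assms(2-4)] Lindelof_condensing)
qed

end
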